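(* Let $P$ be a finite partially ordered set. Then the order complex $\triangle(I(P))$ of its poset of intervals is isomorphic to a Tchebyshev triangulation of $\triangle(P)$ as follows. For each $u\in P$ identify the vertex $[u,u]$ of $\triangle(I(P))$ with the vertex $u$ of $\triangle(P)$, and for each nonsingleton interval $[u,v]\in I(P)$ identify the vertex $[u,v]$ of $\triangle(I(P))$ with the midpoint of the edge $\{u,v\}$ of $\triangle(P)$. Number the midpoints $[u_1,v_1],[u_2,v_2],\ldots$ (equivalently, the edges of $\triangle(P)$) in such an order that $i<j$ holds whenever the interval $[u_i,v_i]$ contains the interval $[u_j,v_j]$ (for $i\neq j$). Then, under these identifications, $\triangle(I(P))$ is the Tchebyshev triangulation of $\triangle(P)$ associated to this numbering.
   Context: An interval $[u,v]$ of a poset $P$ (for $u\le v$) is the set of all $w\in P$ with $u\le w\le v$. For a finite poset $P$, the poset of intervals $I(P)$ is the set of all (nonempty) intervals $[u,v]\subseteq P$, ordered by inclusion. The order complex $\triangle(P)$ of a finite poset $P$ is the simplicial complex whose vertices are the elements of $P$ and whose faces are the increasing chains (including the empty chain). A finite simplicial complex $\triangle$ is a family of subsets (faces) of a finite vertex set, closed under taking subsets and containing every singleton. The link of a face $\sigma$ is $\operatorname{link}_{\triangle}(\sigma)=\{\tau\in\triangle:\ \sigma\cap\tau=\emptyset,\ \sigma\cup\tau\in\triangle\}$. Tchebyshev triangulation of $\triangle$: number the edges $e_1,\ldots,e_m$ of $\triangle$ in some order, and associate to each edge $e_i=\{u_i,v_i\}$ a new vertex $w_i$, its midpoint. Set $\triangle_0=\triangle$.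 For $i\ge 1$, $\triangle_i$ is obtained from $\triangle_{i-1}$ by the stellar subdivision of the edge $e_i$ at $w_i$: remove all faces containing $e_i$, and for each $\tau\in\operatorname{link}_{\triangle_{i-1}}(e_i)$ add all sets $\sigma'\cup\tau$, where $\sigma'$ is a face of the path $L_i$ with vertex set $\{u_i,v_i,w_i\}$ and edge set $\{\{u_i,w_i\},\{w_i,v_i\}\}$. The complex $\triangle_m$ is the Tchebyshev triangulation of $\triangle$ associated to this numbering of the edges. *)

theory Defs
  imports Main
begin

text \<open>A finite poset is a finite set \<open>P\<close> with a relation \<open>r\<close> satisfying
  \<^term>\<open>partial_order_on P r\<close>; here \<open>(u, v) \<in> r\<close> means \<open>u \<le> v\<close>.\<close>

definition interval :: "'a set \<Rightarrow> ('a \<times> 'a) set \<Rightarrow> 'a \<Rightarrow> 'a \<Rightarrow> 'a set" where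
  "interval P r u v = {w \<in> P. (u, w) \<in> r \<and> (w, v) \<in> r}"

definition intervals :: "'a set \<Rightarrow> ('a \<times> 'a) set \<Rightarrow> 'a set set" where
  "intervals P r = {interval P r u v | u v. u \<in> P \<and> v \<in> P \<and> (u, v) \<in> r}"

definition interval_order :: "'a set \<Rightarrow> ('a \<times> 'a) set \<Rightarrow> ('a set \<times> 'a set) set" where
  "interval_order P r = relation_of (\<subseteq>) (intervals P r)"


text \<open>A simplicial complex is represented by its set of faces, including the empty face; since
  every vertex is a face, its vertex set is the union of its faces.\<close>

definition order_complex :: "'a set \<Rightarrow> ('a \<times> 'a) set \<Rightarrow> 'a set set" where
  "order_complex P r = {C. C \<subseteq> P \<and> C \<in> Chains r}"

definition vertices :: "'v set set \<Rightarrow> 'v set" where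
  "vertices K = \<Union>K"

definition edges :: "'v set set \<Rightarrow> 'v set set" where
  "edges K = {e \<in> K. card e = 2}"

definition link :: "'v set set \<Rightarrow> 'v set \<Rightarrow> 'v set set" where
  "link K \<sigma> = {\<tau> \<in> K. \<sigma> \<inter> \<tau> = {} \<and> \<sigma> \<union> \<tau> \<in> K}"

definition simplicial_iso :: "('v \<Rightarrow> 'w) \<Rightarrow> 'v set set \<Rightarrow> 'w set set \<Rightarrow> bool" where
  "simplicial_iso f K L \<longleftrightarrow>
     bij_betw f (vertices K) (vertices L) \<and>
     (\<forall>\<sigma>. \<sigma> \<subseteq> vertices K \<longrightarrow> (\<sigma> \<in> K \<longleftrightarrow> f ` \<sigma> \<in> L))"


text \<open>For \<open>e = {u, v}\<close> these are the faces of the path \<open>u - w - v\<close>.\<close>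

definition subdivided_edge :: "'v set \<Rightarrow> 'v \<Rightarrow> 'v set set" where
  "subdivided_edge e w = {{}} \<union> {{x} | x. x \<in> insert w e} \<union> {{x, w} | x. x \<in> e}"

definition stellar_subdivision :: "'v set \<Rightarrow> 'v \<Rightarrow> 'v set set \<Rightarrow> 'v set set" where
  "stellar_subdivision e w K =
     {\<sigma> \<in> K. \<not> e \<subseteq> \<sigma>} \<union>
     {\<sigma>' \<union> \<tau> | \<sigma>' \<tau>. \<sigma>' \<in> subdivided_edge e w \<and> \<tau> \<in> link K e}"

text \<open>The disjoint copies ensure that midpoints are new vertices, distinct from each other and
  from the original ones.\<close>

datatype 'v subdiv_vertex = Original 'v | Midpoint "'v set"

definition edge_numbering :: "'v set set \<Rightarrow> 'v set list \<Rightarrow> bool" where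
  "edge_numbering K es \<longleftrightarrow> distinct es \<and> set es = edges K"

definition tchebyshev_triangulation ::
    "'v set set \<Rightarrow> 'v set list \<Rightarrow> 'v subdiv_vertex set set" where
  "tchebyshev_triangulation K es =
     fold (\<lambda>e. stellar_subdivision (Original ` e) (Midpoint e)) es ((`) Original ` K)"

definition containment_ordered :: "'a set \<Rightarrow> ('a \<times> 'a) set \<Rightarrow> 'a set list \<Rightarrow> bool" where
  "containment_ordered P r es \<longleftrightarrow>
     (\<forall>i<length es. \<forall>j<length es. \<forall>u v u' v'.
        i \<noteq> j \<and>
        es ! i = {u, v} \<and> (u, v) \<in> r \<and>
        es ! j = {u', v'} \<and> (u', v') \<in> r \<and>
        interval P r u' v' \<subseteq> interval P r u v \<longrightarrow> i < j)"

end

theory Submission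
  imports Defs
begin

text \<open>Every complex occurring in the construction is a flag complex. Subdividing an edge \<open>{u, v}\<close>
  of a flag complex deletes that edge from the underlying graph and joins the midpoint to \<open>u\<close>, \<open>v\<close>
  and their common neighbours. In the prescribed order,
  when it is the turn of \<open>{u, v}\<close>, all edges whose interval properly contains \<open>[u, v]\<close> have been
  subdivided and none whose interval lies inside \<open>[u, v]\<close>. So the common neighbours of \<open>u\<close> and \<open>v\<close>
  are the other elements of \<open>[u, v]\<close> and the midpoints of the larger intervals containing \<open>[u, v]\<close>.
  Hence at the end two vertices are adjacent if and
  only if the corresponding intervals are nested.\<close>

section \<open>Clique complexes and the subdivision of an edge\<close>

text \<open>The flag complex of a graph whose adjacency is \<open>R\<close>. The case
  \<open>a = b\<close> is included, as in \<open>Chains\<close>, so order complexes are instances;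
  in return, a point \<open>a\<close> spans a vertex only if \<open>R a a\<close>.\<close>

definition clique_complex :: "'v set \<Rightarrow> ('v \<Rightarrow> 'v \<Rightarrow> bool) \<Rightarrow> 'v set set" where
  "clique_complex V R = {\<sigma>. \<sigma> \<subseteq> V \<and> (\<forall>a\<in>\<sigma>. \<forall>b\<in>\<sigma>. R a b)}"

lemma clique_complex_cong:
  assumes "V = W" "\<And>a b. a \<in> V \<Longrightarrow> b \<in> V \<Longrightarrow> R a b \<longleftrightarrow> S a b"
  shows "clique_complex V R = clique_complex W S"
  using assms unfolding clique_complex_def by blast

lemma vertices_clique_complex:
  assumes "\<And>a. a \<in> V \<Longrightarrow> R a a"
  shows "vertices (clique_complex V R) = V"
proof -
  have "{a} \<in> clique_complex V R" if "a \<in> V" for a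
    using that assms by (simp add: clique_complex_def)
  then show ?thesis
    unfolding vertices_def clique_complex_def by blast
qed

lemma image_clique_complex:
  assumes "inj f"
  shows "(`) f ` clique_complex V R = clique_complex (f ` V) (\<lambda>a b. R (inv f a) (inv f b))"
proof
  show "(`) f ` clique_complex V R \<subseteq> clique_complex (f ` V) (\<lambda>a b. R (inv f a) (inv f b))"
    using assms by (auto simp: clique_complex_def)
next
  show "clique_complex (f ` V) (\<lambda>a b. R (inv f a) (inv f b)) \<subseteq> (`) f ` clique_complex V R"
  proof
    fix \<sigma> assume \<sigma>: "\<sigma> \<in> clique_complex (f ` V) (\<lambda>a b. R (inv f a) (inv f b))"
    then obtain \<tau> where "\<tau> \<subseteq> V" "\<sigma> = f ` \<tau>"
      unfolding clique_complex_def by (auto simp: subset_image_iff)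
    with \<sigma> assms show "\<sigma> \<in> (`) f ` clique_complex V R"
      by (auto simp: clique_complex_def)
  qed
qed

text \<open>A clique complex is determined by its graph, so an isomorphism of graphs is already
  simplicial.\<close>

lemma simplicial_iso_clique_complex:
  assumes f: "bij_betw f V W"
    and rel: "\<And>a b. a \<in> V \<Longrightarrow> b \<in> V \<Longrightarrow> R a b \<longleftrightarrow> S (f a) (f b)"
    and refl: "\<And>a. a \<in> V \<Longrightarrow> R a a"
  shows "simplicial_iso f (clique_complex V R) (clique_complex W S)"
proof -
  have "S b b" if "b \<in> W" for b
    using that f rel refl by (metis bij_betw_imp_surj_on imageE)
  then have "vertices (clique_complex W S) = W"
    by (rule vertices_clique_complex)
  moreover have "vertices (clique_complex V R) = V"
    using refl by (rule vertices_clique_complex)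
  moreover have "\<sigma> \<in> clique_complex V R \<longleftrightarrow> f ` \<sigma> \<in> clique_complex W S" if "\<sigma> \<subseteq> V" for \<sigma>
  proof -
    have "f ` \<sigma> \<subseteq> W"
      using that f by (auto simp: bij_betw_def)
    moreover have "(\<forall>a\<in>\<sigma>. \<forall>b\<in>\<sigma>. R a b) \<longleftrightarrow> (\<forall>a\<in>\<sigma>. \<forall>b\<in>\<sigma>. S (f a) (f b))"
      using that rel by blast
    ultimately show ?thesis
      using that by (simp add: clique_complex_def)
  qed
  ultimately show ?thesis
    using f by (simp add: simplicial_iso_def)
qed

text \<open>Stellar subdivision of an edge keeps the flag property. A clique of \<open>S\<close>
  through \<open>w\<close> lies in the closed star of the edge \<open>{u, v}\<close> but cannot
  contain both ends; removing \<open>u\<close>, \<open>v\<close> and \<open>w\<close> from it leaves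
  a face of the link. \<open>S_new\<close> makes \<open>w\<close> adjacent to \<open>u\<close> and
  \<open>v\<close> as well, by \<open>refl\<close>, \<open>sym\<close> and
  \<open>Ruv\<close>.\<close>

lemma stellar_subdivision_clique_complex:
  assumes w: "w \<notin> V" and uv: "u \<in> V" "v \<in> V"
    and refl: "\<And>a. a \<in> V \<Longrightarrow> R a a" and sym: "\<And>a b. R a b \<Longrightarrow> R b a" and Ruv: "R u v"
    and S_old: "\<And>a b. a \<in> V \<Longrightarrow> b \<in> V \<Longrightarrow> S a b \<longleftrightarrow> R a b \<and> {a, b} \<noteq> {u, v}"
    and S_new: "\<And>a. a \<in> V \<Longrightarrow> S w a \<longleftrightarrow> R a u \<and> R a v"
    and S_sym: "\<And>a b. S a b \<Longrightarrow> S b a" and S_w: "S w w"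
    and "u \<noteq> v"
  shows "stellar_subdivision {u, v} w (clique_complex V R) = clique_complex (insert w V) S"
proof (intro set_eqI iffI)
  fix \<sigma>
  have S_new': "S a w \<longleftrightarrow> R a u \<and> R a v" if "a \<in> V" for a
    using S_new[OF that] S_sym by blast
  {
    assume "\<sigma> \<in> stellar_subdivision {u, v} w (clique_complex V R)"
    then consider "\<sigma> \<in> clique_complex V R" "\<not> {u, v} \<subseteq> \<sigma>"
      | \<sigma>' \<tau> where "\<sigma> = \<sigma>' \<union> \<tau>" "\<sigma>' \<in> subdivided_edge {u, v} w"
          "\<tau> \<in> link (clique_complex V R) {u, v}"
      unfolding stellar_subdivision_def by blast
    then show "\<sigma> \<in> clique_complex (insert w V) S"
    proof cases
      case 1
      then have "S a b" if "a \<in> \<sigma>" "b \<in> \<sigma>" for a b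
        using that S_old[of a b] by (auto simp: clique_complex_def doubleton_eq_iff)
      then show ?thesis
        using 1 by (auto simp: clique_complex_def)
    next
      case 2
      have \<tau>: "\<tau> \<subseteq> V" "u \<notin> \<tau>" "v \<notin> \<tau>"
        and R\<tau>: "\<And>a b. a \<in> insert u (insert v \<tau>) \<Longrightarrow> b \<in> insert u (insert v \<tau>) \<Longrightarrow> R a b"
        using 2(3) by (auto simp: link_def clique_complex_def)
      \<comment> \<open>Each face of the path lies in one of its halves \<open>{u, w}\<close> and
        \<open>{v, w}\<close>, so it is enough to check the pairs in the join of one half with
        \<open>\<tau>\<close>.\<close>
      have S\<tau>: "S a b" if ab: "a \<in> insert x (insert w \<tau>)" "b \<in> insert x (insert w \<tau>)"
        and x: "x \<in> {u, v}" for a b x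
      proof -
        consider "a = w" "b = w" | "a = w" "b \<in> insert x \<tau>" | "a \<in> insert x \<tau>" "b = w"
          | "a \<in> insert x \<tau>" "b \<in> insert x \<tau>"
          using ab by blast
        then show ?thesis
        proof cases
          case 4
          then have "{a, b} \<noteq> {u, v}"
            using \<tau> \<open>u \<noteq> v\<close> x by (auto simp: doubleton_eq_iff)
          moreover have "R a b" "a \<in> V" "b \<in> V"
            using 4 R\<tau> \<tau>(1) uv x by blast+
          ultimately show ?thesis using S_old by blast
        next
          case 2
          then have "b \<in> V" "R b u" "R b v"
            using R\<tau> \<tau>(1) uv x by blast+
          then show ?thesis using 2 S_new by blast
        next
          case 3
          then have "a \<in> V" "R a u" "R a v"
            using R\<tau> \<tau>(1) uv x by blast+
          then show ?thesis using 3 S_new' by blast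
        qed (simp add: S_w)
      qed
      obtain x where x: "x \<in> {u, v}" "\<sigma> \<subseteq> insert x (insert w \<tau>)"
        using 2(1,2) unfolding subdivided_edge_def by blast
      have "S a b" if "a \<in> \<sigma>" "b \<in> \<sigma>" for a b
        using that x by (intro S\<tau>[of a x b]) auto
      moreover have "\<sigma> \<subseteq> insert w V"
        using x \<tau>(1) uv by blast
      ultimately show ?thesis
        by (simp add: clique_complex_def)
    qed
  }
  assume \<sigma>: "\<sigma> \<in> clique_complex (insert w V) S"
  have not_uv: "\<not> {u, v} \<subseteq> \<sigma>"
    using \<sigma> S_old[OF uv] by (auto simp: clique_complex_def)
  have \<sigma>V: "a \<in> V" if "a \<in> \<sigma> - {w}" for a
    using that \<sigma> by (auto simp: clique_complex_def)
  have S\<sigma>: "S a b" if "a \<in> \<sigma>" "b \<in> \<sigma>" for a b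
    using that \<sigma> by (simp add: clique_complex_def)
  have R\<sigma>: "R a b" if "a \<in> \<sigma> - {w}" "b \<in> \<sigma> - {w}" for a b
    using that \<sigma>V S\<sigma>[of a b] S_old[of a b] by blast
  show "\<sigma> \<in> stellar_subdivision {u, v} w (clique_complex V R)"
  proof (cases "w \<in> \<sigma>")
    case False
    then have "\<sigma> \<in> clique_complex V R"
      using \<sigma>V R\<sigma> by (auto simp: clique_complex_def)
    then show ?thesis
      using not_uv by (simp add: stellar_subdivision_def)
  next
    case True
    \<comment> \<open>The required decomposition: the part of \<open>\<sigma>\<close> on the path,
      and the rest, whose elements are adjacent to \<open>w\<close> and therefore to both
      \<open>u\<close> and \<open>v\<close>.\<close>
    let ?\<tau> = "\<sigma> - {u, v, w}"
    have Ruv\<tau>: "R a u" "R a v" "R u a" "R v a" if "a \<in> ?\<tau>" for a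
      using that \<sigma>V[of a] S\<sigma>[OF True, of a] S_new[of a] sym by blast+
    have "?\<tau> \<subseteq> V"
      using \<sigma>V by blast
    then have "?\<tau> \<in> link (clique_complex V R) {u, v}"
      using Ruv\<tau> R\<sigma> uv refl Ruv sym[OF Ruv] unfolding link_def clique_complex_def by auto
    moreover have "\<sigma> \<inter> {u, v, w} \<in> subdivided_edge {u, v} w"
    proof -
      consider "\<sigma> \<inter> {u, v, w} = {w}" | "\<sigma> \<inter> {u, v, w} = {u, w}" | "\<sigma> \<inter> {u, v, w} = {v, w}"
        using True not_uv by blast
      then show ?thesis
        by cases (auto simp: subdivided_edge_def)
    qed
    moreover have "\<sigma> = \<sigma> \<inter> {u, v, w} \<union> ?\<tau>"
      by blast
    ultimately show ?thesis
      unfolding stellar_subdivision_def by blast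
  qed
qed

section \<open>Finite posets and the edges of their order complexes\<close>

locale finite_poset =
  fixes P :: "'a set" and r :: "('a \<times> 'a) set"
  assumes finite_P: "finite P" and partial_order: "partial_order_on P r"
begin

lemma rel_in_P: "(u, v) \<in> r \<Longrightarrow> u \<in> P \<and> v \<in> P"
  using partial_order by (auto simp: partial_order_on_def preorder_on_def)

lemma rel_refl: "u \<in> P \<Longrightarrow> (u, u) \<in> r"
  using partial_order by (auto simp: partial_order_on_def preorder_on_def refl_on_def)

lemma rel_trans: "(u, v) \<in> r \<Longrightarrow> (v, w) \<in> r \<Longrightarrow> (u, w) \<in> r"
  using partial_order by (meson partial_order_on_def preorder_on_def transD)

lemma rel_antisym: "(u, v) \<in> r \<Longrightarrow> (v, u) \<in> r \<Longrightarrow> u = v"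
  using partial_order by (meson partial_order_on_def antisymD)

definition comparable :: "'a \<Rightarrow> 'a \<Rightarrow> bool" where
  "comparable x y \<longleftrightarrow> (x, y) \<in> r \<or> (y, x) \<in> r"

lemma order_complex_eq: "order_complex P r = clique_complex P comparable"
  by (auto simp: order_complex_def clique_complex_def Chains_def comparable_def)

lemma order_complex_intervals_eq:
  "order_complex (intervals P r) (interval_order P r) =
     clique_complex (intervals P r) (\<lambda>I J. I \<subseteq> J \<or> J \<subseteq> I)"
  unfolding order_complex_def clique_complex_def Chains_def interval_order_def relation_of_def
  by blast

abbreviation E :: "'a set set" where
  "E \<equiv> edges (order_complex P r)"

lemma edgeI: "(u, v) \<in> r \<Longrightarrow> u \<noteq> v \<Longrightarrow> {u, v} \<in> E"
  using rel_in_P rel_refl by (auto simp: edges_def order_complex_eq clique_complex_def comparable_def)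

lemma edgeE:
  assumes "e \<in> E"
  obtains u v where "e = {u, v}" "(u, v) \<in> r" "u \<noteq> v"
proof -
  obtain x y where "e = {x, y}" "x \<noteq> y" "comparable x y"
    using assms by (auto simp: edges_def order_complex_eq clique_complex_def card_2_iff)
  then show ?thesis
    using that by (metis comparable_def insert_commute)
qed

lemma edge_iff: "x \<noteq> y \<Longrightarrow> {x, y} \<in> E \<longleftrightarrow> comparable x y"
  using rel_in_P rel_refl
  by (auto simp: edges_def order_complex_eq clique_complex_def comparable_def)

lemma finite_edges: "finite E"
  using finite_P by (intro finite_subset[of E "Pow P"]) (auto simp: edges_def order_complex_def)

section \<open>Intervals spanned by edges, and numberings ordered by containment\<close>

text \<open>The order-convex hull. It recovers the interval from an unordered edge without choosing
  which end is the smaller one, and covers singletons by the same formula.\<close>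

definition hull :: "'a set \<Rightarrow> 'a set" where
  "hull e = {w. \<exists>a\<in>e. \<exists>b\<in>e. (a, w) \<in> r \<and> (w, b) \<in> r}"

lemma hull_pair: "(u, v) \<in> r \<Longrightarrow> hull {u, v} = interval P r u v"
  unfolding hull_def interval_def using rel_in_P rel_trans by blast

lemma hull_singleton: "u \<in> P \<Longrightarrow> hull {u} = {u}"
  unfolding hull_def using rel_refl rel_antisym by blast

text \<open>The ends \<open>u\<close> and \<open>v\<close> belong to the first interval because
  \<open>(u, v) \<in> r\<close>, so containment can be tested on them.\<close>

lemma interval_subset_iff:
  assumes "(u, v) \<in> r"
  shows "interval P r u v \<subseteq> interval P r x y \<longleftrightarrow> (x, u) \<in> r \<and> (v, y) \<in> r"
proof
  assume "interval P r u v \<subseteq> interval P r x y"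
  moreover have "u \<in> interval P r u v" "v \<in> interval P r u v"
    using assms rel_in_P rel_refl by (auto simp: interval_def)
  ultimately show "(x, u) \<in> r \<and> (v, y) \<in> r"
    by (auto simp: interval_def)
next
  assume "(x, u) \<in> r \<and> (v, y) \<in> r"
  then show "interval P r u v \<subseteq> interval P r x y"
    unfolding interval_def using rel_trans by blast
qed

lemma interval_inj:
  assumes "(u, v) \<in> r" "(x, y) \<in> r" "interval P r u v = interval P r x y"
  shows "u = x \<and> v = y"
  using assms interval_subset_iff[of u v x y] interval_subset_iff[of x y u v] rel_antisym by blast

lemma hull_inj: "e \<in> E \<Longrightarrow> f \<in> E \<Longrightarrow> hull e = hull f \<Longrightarrow> e = f"
  by (metis edgeE hull_pair interval_inj)

text \<open>Frees the ordering condition from the choice of endpoints: every edge can be written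
  with its smaller end first, and then its hull is the interval in question.\<close>

lemma containment_ordered_iff:
  assumes "edge_numbering (order_complex P r) es"
  shows "containment_ordered P r es \<longleftrightarrow>
    (\<forall>i<length es. \<forall>j<length es. i \<noteq> j \<and> hull (es ! j) \<subseteq> hull (es ! i) \<longrightarrow> i < j)"
    (is "_ \<longleftrightarrow> ?rhs")
proof
  assume co: "containment_ordered P r es"
  show ?rhs
  proof (intro allI impI)
    fix i j assume i: "i < length es" and j: "j < length es"
      and ij: "i \<noteq> j \<and> hull (es ! j) \<subseteq> hull (es ! i)"
    have "es ! i \<in> E" "es ! j \<in> E"
      using i j assms nth_mem unfolding edge_numbering_def by blast+
    then obtain u v u' v' where "es ! i = {u, v}" "(u, v) \<in> r" "es ! j = {u', v'}" "(u', v') \<in> r"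
      by (meson edgeE)
    then show "i < j"
      using co i j ij hull_pair unfolding containment_ordered_def by metis
  qed
next
  assume ?rhs
  then show "containment_ordered P r es"
    unfolding containment_ordered_def by (metis hull_pair)
qed

text \<open>Sorting the edges by decreasing size of their intervals works, because nested intervals
  of equal size coincide and then come from the same edge.\<close>

lemma ex_containment_ordered_numbering:
  "\<exists>es. edge_numbering (order_complex P r) es \<and> containment_ordered P r es"
proof -
  obtain fs where fs: "set fs = E" "distinct fs"
    using finite_distinct_list[OF finite_edges] by blast
  \<comment> \<open>The minus sign makes the ascending sort list the largest hulls first.\<close>
  define key where "key = (\<lambda>e. - int (card (hull e)))"
  define es where "es = sort_key key fs"
  have num: "edge_numbering (order_complex P r) es"
    using fs by (simp add: edge_numbering_def es_def)
  have "i < j" if "i < length es" "j < length es" "i \<noteq> j" "hull (es ! j) \<subseteq> hull (es ! i)" for i j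
  proof (rule ccontr)
    \<comment> \<open>If \<open>j\<close> came no later than \<open>i\<close>, its hull would have
      at least as many elements as the finite hull containing it, so the two would be equal.\<close>
    assume "\<not> i < j"
    then have "key (es ! j) \<le> key (es ! i)"
      using that sorted_nth_mono[of "map key es" j i] by (simp add: es_def)
    moreover have "finite (hull (es ! i))"
      by (rule finite_subset[OF _ finite_P]) (use rel_in_P in \<open>auto simp: hull_def\<close>)
    ultimately have "hull (es ! j) = hull (es ! i)"
      using that(4) by (simp add: key_def card_seteq)
    then have "es ! j = es ! i"
      using that num hull_inj nth_mem unfolding edge_numbering_def by metis
    then show False
      using that num nth_eq_iff_index_eq unfolding edge_numbering_def by metis
  qed
  then show ?thesis
    using num containment_ordered_iff by blast
qed

section \<open>Graphs of the intermediate complexes\<close>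

text \<open>The identification of the theorem read backwards, from vertices of the subdivision to
  intervals.\<close>

fun support :: "'a subdiv_vertex \<Rightarrow> 'a set" where
  "support (Original u) = hull {u}"
| "support (Midpoint e) = hull e"

definition nested :: "'a subdiv_vertex \<Rightarrow> 'a subdiv_vertex \<Rightarrow> bool" where
  "nested a b \<longleftrightarrow> support a \<subseteq> support b \<or> support b \<subseteq> support a"

definition subdiv_vertices :: "'a set set \<Rightarrow> 'a subdiv_vertex set" where
  "subdiv_vertices D = Original ` P \<union> Midpoint ` D"

text \<open>Adjacency in the complex in which exactly the edges in \<open>D\<close> have been subdivided.\<close>

definition adjacent :: "'a set set \<Rightarrow> 'a subdiv_vertex \<Rightarrow> 'a subdiv_vertex \<Rightarrow> bool" where
  "adjacent D a b \<longleftrightarrow> nested a b \<or>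
     (\<exists>x y. a = Original x \<and> b = Original y \<and> comparable x y \<and> {x, y} \<notin> D)"

lemma adjacent_sym: "adjacent D a b \<Longrightarrow> adjacent D b a"
  by (auto simp: adjacent_def nested_def comparable_def insert_commute)

lemma adjacent_refl: "adjacent D a a"
  by (simp add: adjacent_def nested_def)

lemma adjacent_Midpoint: "adjacent D (Midpoint e) a \<longleftrightarrow> nested (Midpoint e) a"
  by (simp add: adjacent_def)

lemma adjacent_Original:
  assumes "x \<in> P" "y \<in> P"
  shows "adjacent D (Original x) (Original y) \<longleftrightarrow> x = y \<or> comparable x y \<and> {x, y} \<notin> D"
  using assms by (auto simp: adjacent_def nested_def hull_singleton)

text \<open>An interval with two distinct ends does not fit into a one-point interval, so only one
  of the two containments can occur.\<close>

lemma nested_Midpoint_Original: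
  assumes "(u, v) \<in> r" "u \<noteq> v" "x \<in> P"
  shows "nested (Midpoint {u, v}) (Original x) \<longleftrightarrow> (u, x) \<in> r \<and> (x, v) \<in> r"
proof -
  have "hull {x} = interval P r x x"
    using hull_pair[OF rel_refl[OF assms(3)]] by simp
  then show ?thesis
    using assms by (auto simp: nested_def hull_pair interval_subset_iff rel_refl
        intro: rel_antisym rel_trans)
qed

text \<open>One step of the construction. The prescribed order enters only through
  \<open>larger\<close> and \<open>smaller\<close>; together they identify the common neighbours of
  the ends of \<open>e\<close> with the vertices nested with its midpoint.\<close>

lemma stellar_subdivision_adjacent:
  assumes "D \<subseteq> E" "e \<in> E" "e \<notin> D"
    and larger: "\<And>f. f \<in> E \<Longrightarrow> hull e \<subset> hull f \<Longrightarrow> f \<in> D"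
    and smaller: "\<And>f. f \<in> D \<Longrightarrow> \<not> hull f \<subseteq> hull e"
  shows "stellar_subdivision (Original ` e) (Midpoint e)
      (clique_complex (subdiv_vertices D) (adjacent D)) =
    clique_complex (subdiv_vertices (insert e D)) (adjacent (insert e D))"
proof -
  obtain u v where e: "e = {u, v}" "(u, v) \<in> r" "u \<noteq> v"
    using assms(2) by (rule edgeE)
  have uv: "u \<in> P" "v \<in> P"
    using e rel_in_P by auto
  \<comment> \<open>Excludes points outside \<open>[u, v]\<close>: for \<open>x\<close> strictly
    below \<open>u\<close> the edge \<open>{x, v}\<close> is already gone, and for \<open>y\<close>
    strictly above \<open>v\<close> the edge \<open>{u, y}\<close> is.\<close>
  have in_D: "{x, y} \<in> D" if "(x, u) \<in> r" "(v, y) \<in> r" "x \<noteq> u \<or> y \<noteq> v" for x y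
  proof -
    have xy: "(x, y) \<in> r" "x \<noteq> y"
      using that e rel_trans rel_antisym by blast+
    then have "hull e \<noteq> hull {x, y}"
      using that(3) e interval_inj[of u v x y] by (auto simp: hull_pair)
    moreover have "hull e \<subseteq> hull {x, y}"
      using that xy e by (simp add: hull_pair interval_subset_iff)
    ultimately have "hull e \<subset> hull {x, y}"
      by blast
    then show ?thesis
      using larger edgeI xy by blast
  qed
  \<comment> \<open>Keeps the points inside \<open>[u, v]\<close>: their edges to \<open>u\<close>
    and \<open>v\<close> are still present.\<close>
  have not_in_D: "{x, y} \<notin> D" if "(x, y) \<in> r" "(u, x) \<in> r" "(y, v) \<in> r" for x y
    using that e smaller by (metis hull_pair interval_subset_iff)
  have new: "nested (Midpoint e) a \<longleftrightarrow> adjacent D a (Original u) \<and> adjacent D a (Original v)"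
    if "a \<in> subdiv_vertices D" for a
  proof (cases a)
    case (Original x)
    then have x: "x \<in> P"
      using that by (auto simp: subdiv_vertices_def)
    have "nested (Midpoint e) a \<longleftrightarrow> (u, x) \<in> r \<and> (x, v) \<in> r"
      using Original x e nested_Midpoint_Original by simp
    also have "\<dots> \<longleftrightarrow> (x = u \<or> comparable x u \<and> {x, u} \<notin> D) \<and> (x = v \<or> comparable x v \<and> {x, v} \<notin> D)"
    proof
      assume "(u, x) \<in> r \<and> (x, v) \<in> r"
      then show "(x = u \<or> comparable x u \<and> {x, u} \<notin> D) \<and> (x = v \<or> comparable x v \<and> {x, v} \<notin> D)"
        using not_in_D[of u x] not_in_D[of x v] uv rel_refl
        by (auto simp: comparable_def insert_commute)
    next
      assume *: "(x = u \<or> comparable x u \<and> {x, u} \<notin> D) \<and> (x = v \<or> comparable x v \<and> {x, v} \<notin> D)"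
      show "(u, x) \<in> r \<and> (x, v) \<in> r"
        using * in_D[of x v] in_D[of u x] e uv rel_refl
        by (auto simp: comparable_def insert_commute)
    qed
    also have "\<dots> \<longleftrightarrow> adjacent D a (Original u) \<and> adjacent D a (Original v)"
      using Original x uv by (simp add: adjacent_Original)
    finally show ?thesis .
  next
    case (Midpoint f)
    then have f: "f \<in> D"
      using that by (auto simp: subdiv_vertices_def)
    then obtain x y where xy: "f = {x, y}" "(x, y) \<in> r" "x \<noteq> y"
      using assms(1) by (meson edgeE subsetD)
    \<comment> \<open>By \<open>smaller\<close>, an interval subdivided earlier cannot lie inside
      \<open>hull e\<close>, so nesting can only mean that it contains
      \<open>hull e\<close>.\<close>
    have "nested (Midpoint e) a \<longleftrightarrow> hull e \<subseteq> hull f"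
      using Midpoint smaller[OF f] by (auto simp: nested_def)
    also have "\<dots> \<longleftrightarrow> (x, u) \<in> r \<and> (v, y) \<in> r"
      using xy e by (simp add: hull_pair interval_subset_iff)
    also have "\<dots> \<longleftrightarrow> nested a (Original u) \<and> nested a (Original v)"
      using Midpoint xy e uv rel_trans by (auto simp: nested_Midpoint_Original)
    finally show ?thesis
      using Midpoint by (simp add: adjacent_Midpoint)
  qed
  have "stellar_subdivision {Original u, Original v} (Midpoint e)
      (clique_complex (subdiv_vertices D) (adjacent D)) =
    clique_complex (insert (Midpoint e) (subdiv_vertices D)) (adjacent (insert e D))"
  proof (rule stellar_subdivision_clique_complex)
    show "Midpoint e \<notin> subdiv_vertices D"
      using \<open>e \<notin> D\<close> by (auto simp: subdiv_vertices_def)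
    show "Original u \<in> subdiv_vertices D" "Original v \<in> subdiv_vertices D"
      using uv by (auto simp: subdiv_vertices_def)
    show "adjacent D (Original u) (Original v)"
      using e \<open>e \<notin> D\<close> uv by (auto simp: adjacent_Original comparable_def)
    show "Original u \<noteq> Original v"
      using e by simp
    show "adjacent (insert e D) (Midpoint e) a \<longleftrightarrow>
        adjacent D a (Original u) \<and> adjacent D a (Original v)" if "a \<in> subdiv_vertices D" for a
      using new[OF that] by (simp add: adjacent_Midpoint)
    show "adjacent (insert e D) a b \<longleftrightarrow> adjacent D a b \<and> {a, b} \<noteq> {Original u, Original v}"
      if ab: "a \<in> subdiv_vertices D" "b \<in> subdiv_vertices D" for a b
    \<comment> \<open>Only pairs of original vertices can lose an edge; for all other pairs
      \<open>adjacent\<close> does not depend on \<open>D\<close>.\<close>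
    proof (cases "\<exists>x y. a = Original x \<and> b = Original y")
      case True
      then obtain x y where "a = Original x" "b = Original y" "x \<in> P" "y \<in> P"
        using ab by (auto simp: subdiv_vertices_def)
      then show ?thesis
        using e by (auto simp: adjacent_Original doubleton_eq_iff)
    next
      case False
      then show ?thesis
        by (auto simp: adjacent_def doubleton_eq_iff)
    qed
  qed (auto intro: adjacent_sym adjacent_refl)
  then show ?thesis
    by (simp add: e(1) subdiv_vertices_def)
qed

section \<open>Iteration over the numbered edges\<close>

text \<open>The loop invariant, stated for prefixes of the numbering so that the set of subdivided
  edges is explicit at every stage.\<close>

lemma fold_stellar_subdivision:
  assumes num: "edge_numbering (order_complex P r) es" and co: "containment_ordered P r es"
    and "k \<le> length es"
  shows "fold (\<lambda>e. stellar_subdivision (Original ` e) (Midpoint e)) (take k es)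
      ((`) Original ` order_complex P r) =
    clique_complex (subdiv_vertices (set (take k es))) (adjacent (set (take k es)))"
  using assms(3)
proof (induction k)
  case 0
  \<comment> \<open>With no edge subdivided, nested original vertices are equal, so
    \<open>adjacent {}\<close> is comparability transported along \<open>Original\<close>.\<close>
  have "(`) Original ` order_complex P r =
      clique_complex (Original ` P)
        (\<lambda>a b. comparable (inv Original a) (inv Original b))"
    unfolding order_complex_eq by (rule image_clique_complex) (simp add: inj_def)
  also have "\<dots> = clique_complex (subdiv_vertices {}) (adjacent {})"
  proof (rule clique_complex_cong)
    have "inv Original (Original x) = x" for x :: 'a
      by (simp add: inj_def)
    then show "comparable (inv Original a) (inv Original b) \<longleftrightarrow> adjacent {} a b"
      if "a \<in> Original ` P" "b \<in> Original ` P" for a b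
      using that rel_refl by (auto simp: adjacent_Original comparable_def)
  qed (simp add: subdiv_vertices_def)
  finally show ?case
    by simp
next
  case (Suc k)
  let ?D = "set (take k es)" and ?e = "es ! k"
  have k: "k < length es"
    using Suc.prems by simp
  have es: "distinct es" "set es = E"
    using num by (auto simp: edge_numbering_def)
  have order: "i < j" if "i < length es" "j < length es" "i \<noteq> j" "hull (es ! j) \<subseteq> hull (es ! i)"
    for i j
    using that co containment_ordered_iff[OF num] by blast
  have take_Suc: "take (Suc k) es = take k es @ [?e]"
    using k by (rule take_Suc_conv_app_nth)
  have in_D: "f \<in> ?D \<longleftrightarrow> (\<exists>i<k. f = es ! i)" for f
    using k by (auto simp: in_set_conv_nth)
  have "stellar_subdivision (Original ` ?e) (Midpoint ?e)
      (clique_complex (subdiv_vertices ?D) (adjacent ?D)) =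
    clique_complex (subdiv_vertices (insert ?e ?D)) (adjacent (insert ?e ?D))"
  proof (rule stellar_subdivision_adjacent)
    show "?D \<subseteq> E"
      using es set_take_subset by fast
    show "?e \<in> E"
      using es k nth_mem by blast
    show "?e \<notin> ?D"
      using es(1) k in_D by (auto simp: nth_eq_iff_index_eq)
    \<comment> \<open>An edge with a strictly larger hull sits at some index, and the order forces
      that index below \<open>k\<close>.\<close>
    show "f \<in> ?D" if f: "f \<in> E" "hull ?e \<subset> hull f" for f
    proof -
      obtain i where "i < length es" "f = es ! i"
        using f(1) es(2) by (metis in_set_conv_nth)
      then show ?thesis
        using order[of i k] k f(2) in_D by auto
    qed
    show "\<not> hull f \<subseteq> hull ?e" if f: "f \<in> ?D" for f
    proof
      assume sub: "hull f \<subseteq> hull ?e"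
      obtain i where i: "i < k" "f = es ! i"
        using f in_D by blast
      then have "k < i"
        using sub k by (simp add: order)
      then show False
        using i by simp
    qed
  qed
  then show ?case
    using Suc by (simp add: take_Suc)
qed

text \<open>Once all edges are subdivided, comparable \<open>x\<close> and \<open>y\<close> with
  \<open>{x, y}\<close> outside \<open>E\<close> must be equal, so only nesting is left of
  \<open>adjacent\<close>.\<close>

lemma tchebyshev_triangulation_eq:
  assumes "edge_numbering (order_complex P r) es" "containment_ordered P r es"
  shows "tchebyshev_triangulation (order_complex P r) es = clique_complex (subdiv_vertices E) nested"
proof -
  have "tchebyshev_triangulation (order_complex P r) es =
      clique_complex (subdiv_vertices E) (adjacent E)"
    using fold_stellar_subdivision[OF assms order.refl] assms(1)
    by (simp add: tchebyshev_triangulation_def edge_numbering_def)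
  also have "\<dots> = clique_complex (subdiv_vertices E) nested"
  proof (rule clique_complex_cong)
    have "nested (Original x) (Original y)" if "comparable x y" "{x, y} \<notin> E" for x y
      using that edge_iff[of x y] by (cases "x = y") (simp_all add: nested_def)
    then show "adjacent E a b \<longleftrightarrow> nested a b" for a b
      unfolding adjacent_def by blast
  qed simp
  finally show ?thesis .
qed

section \<open>The isomorphism with the order complex of the poset of intervals\<close>

lemma bij_betw_support: "bij_betw support (subdiv_vertices E) (intervals P r)"
proof -
  \<comment> \<open>Writes each vertex as a function of the ends of its interval. Since an interval
    determines its ends, injectivity follows.\<close>
  have endpoints: "\<exists>u v. (u, v) \<in> r \<and> support a = interval P r u v \<and>
      a = (if u = v then Original u else Midpoint {u, v})" if "a \<in> subdiv_vertices E" for a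
  proof (cases a)
    case (Original u)
    then have "u \<in> P"
      using that by (auto simp: subdiv_vertices_def)
    then show ?thesis
      using Original rel_refl hull_pair[of u u] by (intro exI[of _ u]) simp
  next
    case (Midpoint e)
    then have "e \<in> E"
      using that by (auto simp: subdiv_vertices_def)
    then show ?thesis
      using Midpoint hull_pair by (metis edgeE support.simps(2))
  qed
  have "inj_on support (subdiv_vertices E)"
    by (intro inj_onI) (metis endpoints interval_inj)
  moreover have "support a \<in> intervals P r" if "a \<in> subdiv_vertices E" for a
    using endpoints[OF that] rel_in_P unfolding intervals_def by blast
  moreover have "I \<in> support ` subdiv_vertices E" if I: "I \<in> intervals P r" for I
  proof -
    obtain u v where uv: "I = interval P r u v" "u \<in> P" "(u, v) \<in> r"
      using I by (auto simp: intervals_def)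
    show ?thesis
    proof (cases "u = v")
      case True
      then have "I = support (Original u)" "Original u \<in> subdiv_vertices E"
        using uv hull_pair[of u u] by (simp_all add: subdiv_vertices_def)
      then show ?thesis
        by blast
    next
      case False
      then have "I = support (Midpoint {u, v})" "Midpoint {u, v} \<in> subdiv_vertices E"
        using uv by (simp_all add: subdiv_vertices_def hull_pair edgeI)
      then show ?thesis
        by blast
    qed
  qed
  ultimately show ?thesis
    unfolding bij_betw_def by blast
qed

lemma simplicial_iso_tchebyshev:
  assumes "edge_numbering (order_complex P r) es" "containment_ordered P r es"
  shows "\<exists>\<phi> :: 'a set \<Rightarrow> 'a subdiv_vertex.
         (\<forall>u \<in> P. \<phi> (interval P r u u) = Original u) \<and>
         (\<forall>u \<in> P. \<forall>v \<in> P. (u, v) \<in> r \<and> u \<noteq> v \<longrightarrow>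
            \<phi> (interval P r u v) = Midpoint {u, v}) \<and>
         simplicial_iso \<phi> (order_complex (intervals P r) (interval_order P r))
           (tchebyshev_triangulation (order_complex P r) es)"
proof -
  \<comment> \<open>The inverse must be restricted to actual vertices: \<open>Midpoint {u}\<close>,
    which is not one of them, has the same support as \<open>Original u\<close>.\<close>
  define \<phi> where "\<phi> = inv_into (subdiv_vertices E) support"
  have \<phi>_support: "\<phi> (support a) = a" if "a \<in> subdiv_vertices E" for a
    using that bij_betw_support by (simp add: \<phi>_def bij_betw_def)
  have support_\<phi>: "support (\<phi> I) = I" if "I \<in> intervals P r" for I
    using that bij_betw_support by (simp add: \<phi>_def bij_betw_def f_inv_into_f)
  have "\<phi> (interval P r u u) = Original u" if "u \<in> P" for u
    using \<phi>_support[of "Original u"] hull_pair[of u u] that rel_refl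
    by (simp add: subdiv_vertices_def)
  moreover have "\<phi> (interval P r u v) = Midpoint {u, v}" if "(u, v) \<in> r" "u \<noteq> v" for u v
    using \<phi>_support[of "Midpoint {u, v}"] hull_pair[of u v] that edgeI
    by (simp add: subdiv_vertices_def)
  moreover have "simplicial_iso \<phi> (order_complex (intervals P r) (interval_order P r))
      (tchebyshev_triangulation (order_complex P r) es)"
    unfolding order_complex_intervals_eq tchebyshev_triangulation_eq[OF assms]
  proof (rule simplicial_iso_clique_complex)
    show "bij_betw \<phi> (intervals P r) (subdiv_vertices E)"
      unfolding \<phi>_def using bij_betw_support by (rule bij_betw_inv_into)
    show "I \<subseteq> J \<or> J \<subseteq> I \<longleftrightarrow> nested (\<phi> I) (\<phi> J)"
      if "I \<in> intervals P r" "J \<in> intervals P r" for I J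
      using that by (simp add: nested_def support_\<phi>)
  qed simp
  ultimately show ?thesis
    by blast
qed

end

text \<open>The existence clause guarantees that the claim about all admissible numberings is not
  vacuous.\<close>

theorem theorem2p2:
  fixes P :: "'a set" and r :: "('a \<times> 'a) set"
  assumes "finite P" and "partial_order_on P r"
  shows "(\<exists>es. edge_numbering (order_complex P r) es \<and> containment_ordered P r es) \<and>
    (\<forall>es. edge_numbering (order_complex P r) es \<and> containment_ordered P r es \<longrightarrow>
      (\<exists>\<phi> :: 'a set \<Rightarrow> 'a subdiv_vertex.
         (\<forall>u \<in> P. \<phi> (interval P r u u) = Original u) \<and>
         (\<forall>u \<in> P. \<forall>v \<in> P. (u, v) \<in> r \<and> u \<noteq> v \<longrightarrow>
            \<phi> (interval P r u v) = Midpoint {u, v}) \<and>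
         simplicial_iso \<phi> (order_complex (intervals P r) (interval_order P r))
           (tchebyshev_triangulation (order_complex P r) es)))"
proof -
  interpret finite_poset P r
    using assms by unfold_locales
  show ?thesis
    using ex_containment_ordered_numbering simplicial_iso_tchebyshev by blast
qed

end
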